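(* Let $F$ and $K$ be finite fields with $|F|\geq 3$. Then $$\gamma^o(\Gamma(\mathbb{Z}_2 \times K \times F)) = 1 + \min \left\{ 2|K^*|,\ 2|F^*|,\ |F^*| + \left\lfloor \frac{|K^*|}{2} \right\rfloor + 1,\ |K^*|+ \left\lfloor \frac{|F^*|}{2} \right\rfloor + 1 \right\}.$$
   Context: $K^*=K\setminus\{0\}$, $F^*=F\setminus\{0\}$. For a finite commutative ring $R$ with identity, the zero-divisor graph $\Gamma(R)$ is the simple graph whose vertex set is the set of nonzero zero-divisors of $R$, in which distinct $u,v$ are adjacent if and only if $uv=0$. For a simple graph $\Gamma=(V,E)$, a set $S\subseteq V$ and a vertex $v$, let $\delta_S(v)$ be the number of neighbors of $v$ in $S$ and $\overline{S}=V\setminus S$. A nonempty set $S\subseteq V$ is a global offensive alliance if $\delta_S(v)\geq \delta_{\overline{S}}(v)+1$ for every $v\in\overline{S}$. $\gamma^o(\Gamma)$ is the minimum cardinality of a global offensive alliance of $\Gamma$. *)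

theory Defs
  imports
    "HOL-Algebra.Chinese_Remainder"
    "HOL-Number_Theory.Residues"
    "Graph_Theory.Pair_Digraph"
begin

text \<open>
  Zero-divisors in the sense of commutative rings, where left and right zero-divisors coincide.
\<close>

definition zero_divisors :: "('a, 'b) ring_scheme \<Rightarrow> 'a set" where
  "zero_divisors R =
     {a \<in> carrier R. \<exists>b \<in> carrier R. b \<noteq> \<zero>\<^bsub>R\<^esub> \<and> a \<otimes>\<^bsub>R\<^esub> b = \<zero>\<^bsub>R\<^esub>}"

text \<open>
  A finite simple graph is a finite, symmetric, loop-free digraph (locale \<^locale>\<open>pair_graph\<close>): the
  undirected edge between \<open>u\<close> and \<open>v\<close> is represented by the two arcs \<open>(u, v)\<close> and \<open>(v, u)\<close>.
\<close>

definition zero_divisor_graph :: "('a, 'b) ring_scheme \<Rightarrow> 'a pair_pre_digraph" where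
  "zero_divisor_graph R =
     (let V = zero_divisors R - {\<zero>\<^bsub>R\<^esub>}
      in \<lparr> pverts = V,
           parcs = {(u, v). u \<in> V \<and> v \<in> V \<and> u \<noteq> v \<and> u \<otimes>\<^bsub>R\<^esub> v = \<zero>\<^bsub>R\<^esub>} \<rparr>)"

lemma pair_graph_zero_divisor_graph:
  assumes "cring R" "finite (carrier R)"
  shows "pair_graph (zero_divisor_graph R)"
proof -
  interpret cring R by fact
  let ?G = "zero_divisor_graph R"
  have fin: "finite (pverts ?G)"
    by (rule finite_subset[OF _ assms(2)]) (auto simp: zero_divisor_graph_def zero_divisors_def)
  have sub: "parcs ?G \<subseteq> pverts ?G \<times> pverts ?G"
    by (auto simp: zero_divisor_graph_def)
  have "finite (parcs ?G)"
    using finite_subset[OF sub] fin by blast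
  moreover have "symmetric (with_proj ?G)"
    by (auto simp: symmetric_def sym_def arcs_ends_def arc_to_ends_def zero_divisor_graph_def
        zero_divisors_def m_comm)
  ultimately show ?thesis
    using fin sub by unfold_locales (auto simp: zero_divisor_graph_def)
qed

definition nbr_count :: "'a pair_pre_digraph \<Rightarrow> 'a set \<Rightarrow> 'a \<Rightarrow> nat" where
  "nbr_count G S v = card {u \<in> S. (v, u) \<in> parcs G}"

definition global_offensive_alliance :: "'a pair_pre_digraph \<Rightarrow> 'a set \<Rightarrow> bool" where
  "global_offensive_alliance G S \<longleftrightarrow>
     S \<noteq> {} \<and> S \<subseteq> pverts G \<and>
     (\<forall>v \<in> pverts G - S. nbr_count G S v \<ge> nbr_count G (pverts G - S) v + 1)"

text \<open>
  Only meaningful for finite graphs with at least one vertex; then the full vertex set is an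
  alliance, so the minimum exists.
\<close>

definition global_offensive_alliance_number :: "'a pair_pre_digraph \<Rightarrow> nat" where
  "global_offensive_alliance_number G = (LEAST n. \<exists>S. global_offensive_alliance G S \<and> card S = n)"

end

theory Submission
  imports Defs
begin

text \<open>
  A vertex of the graph is determined, up to twins, by its support, so the vertices split into six
  classes and adjacency means disjointness of supports. An alliance \<open>S\<close> is therefore governed by
  the number of elements it has in each class, and the alliance condition becomes a system of linear
  inequalities. A minimum alliance may be assumed to contain \<open>(1, 0, 0)\<close>, since otherwise it
  contains all pendant vertices \<open>(0, x, y)\<close> with \<open>x\<close>, \<open>y\<close> nonzero. It then costs least to take
  one of the two classes \<open>K\<^sup>*\<close>, \<open>F\<^sup>*\<close> completely, together with either its translate by
  \<open>(1, 0, 0)\<close> or just over half of the other class; leaving both classes incomplete already costs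
  \<open>|K\<^sup>*| + |F\<^sup>*|\<close> further vertices.
\<close>

section \<open>Set-theoretic preliminaries\<close>

lemma card_Int_Un_disjoint:
  assumes "finite X" "finite Y" "X \<inter> Y = {}"
  shows "card (T \<inter> (X \<union> Y)) = card (T \<inter> X) + card (T \<inter> Y)"
  using assms by (subst Int_Un_distrib, intro card_Un_disjoint) auto

text \<open>Twins satisfy the same alliance inequality, so the condition on a class collapses to one
  inequality. It is vacuous exactly when the finite class lies inside \<open>S\<close>, which the
  cardinality guard detects.\<close>

lemma ball_diff_const_iff:
  assumes "finite X"
  shows "(\<forall>v\<in>X - S. R) \<longleftrightarrow> (card (S \<inter> X) < card X \<longrightarrow> R)"
proof -
  have "card (S \<inter> X) < card X \<longleftrightarrow> X - S \<noteq> {}"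
    using assms by (metis Diff_eq_empty_iff Int_lower2 card_subset_eq inf.absorb_iff2
        nat_less_le psubset_card_mono psubsetI)
  then show ?thesis by auto
qed

text \<open>Membership in the vertex and arc sets is described below for explicit triples; this form
  of extensionality makes those descriptions applicable as rewrite rules.\<close>

lemma set_triple_eqI:
  assumes "\<And>x y z. (x, y, z) \<in> X \<longleftrightarrow> (x, y, z) \<in> Y"
  shows "X = Y"
  using assms by auto

text \<open>
  The classes \<open>E\<close>, \<open>A\<close>, \<open>B\<close>, \<open>C\<close>, \<open>P\<close>, \<open>Q\<close> stand for the supports
  \<open>{1}\<close>, \<open>{2}\<close>, \<open>{3}\<close>, \<open>{2, 3}\<close>, \<open>{1, 2}\<close>, \<open>{1, 3}\<close>.
\<close>

locale three_support_graph =
  fixes G :: "'a pair_pre_digraph" and E A B C P Q :: "'a set" and k f :: nat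
  assumes verts: "pverts G = E \<union> A \<union> B \<union> C \<union> P \<union> Q"
    and finite_classes: "finite E" "finite A" "finite B" "finite C" "finite P" "finite Q"
    and disjoint_classes:
      "E \<inter> A = {}" "E \<inter> B = {}" "E \<inter> C = {}" "E \<inter> P = {}" "E \<inter> Q = {}"
      "A \<inter> B = {}" "A \<inter> C = {}" "A \<inter> P = {}" "A \<inter> Q = {}" "B \<inter> C = {}"
      "B \<inter> P = {}" "B \<inter> Q = {}" "C \<inter> P = {}" "C \<inter> Q = {}" "P \<inter> Q = {}"
    and card_classes: "card E = 1" "card A = k" "card B = f" "card C = k * f" "card P = k" "card Q = f"
    and nbrs_E: "v \<in> E \<Longrightarrow> {u. (v, u) \<in> parcs G} = A \<union> B \<union> C"
    and nbrs_A: "v \<in> A \<Longrightarrow> {u. (v, u) \<in> parcs G} = E \<union> B \<union> Q"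
    and nbrs_B: "v \<in> B \<Longrightarrow> {u. (v, u) \<in> parcs G} = E \<union> A \<union> P"
    and nbrs_C: "v \<in> C \<Longrightarrow> {u. (v, u) \<in> parcs G} = E"
    and nbrs_P: "v \<in> P \<Longrightarrow> {u. (v, u) \<in> parcs G} = B"
    and nbrs_Q: "v \<in> Q \<Longrightarrow> {u. (v, u) \<in> parcs G} = A"
    and sizes: "k \<ge> 1" "f \<ge> 2"
begin

section \<open>The alliance condition in terms of class counts\<close>

lemma nbr_count_eq_card_Int: "nbr_count G T v = card (T \<inter> {u. (v, u) \<in> parcs G})"
  unfolding nbr_count_def by (rule arg_cong[where f = card]) auto

lemma nbr_counts:
  "v \<in> E \<Longrightarrow> nbr_count G T v = card (T \<inter> A) + card (T \<inter> B) + card (T \<inter> C)"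
  "v \<in> A \<Longrightarrow> nbr_count G T v = card (T \<inter> E) + card (T \<inter> B) + card (T \<inter> Q)"
  "v \<in> B \<Longrightarrow> nbr_count G T v = card (T \<inter> E) + card (T \<inter> A) + card (T \<inter> P)"
  "v \<in> C \<Longrightarrow> nbr_count G T v = card (T \<inter> E)"
  "v \<in> P \<Longrightarrow> nbr_count G T v = card (T \<inter> B)"
  "v \<in> Q \<Longrightarrow> nbr_count G T v = card (T \<inter> A)"
  using finite_classes disjoint_classes
  by (simp_all add: nbr_count_eq_card_Int nbrs_E nbrs_A nbrs_B nbrs_C nbrs_P nbrs_Q
      card_Int_Un_disjoint Int_Un_distrib2)

lemma card_diff_Int:
  assumes "X \<subseteq> pverts G" "finite X"
  shows "card ((pverts G - S) \<inter> X) = card X - card (S \<inter> X)"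
proof -
  have "(pverts G - S) \<inter> X = X - S \<inter> X"
    using assms by auto
  then show ?thesis
    using assms by (simp add: card_Diff_subset)
qed

lemma card_complement_Int:
  "card ((pverts G - S) \<inter> E) = 1 - card (S \<inter> E)"
  "card ((pverts G - S) \<inter> A) = k - card (S \<inter> A)"
  "card ((pverts G - S) \<inter> B) = f - card (S \<inter> B)"
  "card ((pverts G - S) \<inter> C) = k * f - card (S \<inter> C)"
  "card ((pverts G - S) \<inter> P) = k - card (S \<inter> P)"
  "card ((pverts G - S) \<inter> Q) = f - card (S \<inter> Q)"
  using finite_classes card_classes by (subst card_diff_Int; auto simp: verts)+

lemma card_Int_classes_le:
  "card (S \<inter> E) \<le> 1" "card (S \<inter> A) \<le> k" "card (S \<inter> B) \<le> f"
  "card (S \<inter> C) \<le> k * f" "card (S \<inter> P) \<le> k" "card (S \<inter> Q) \<le> f"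
  using finite_classes card_classes by (metis Int_lower2 card_mono)+

lemma card_eq_sum_classes:
  assumes "S \<subseteq> pverts G"
  shows "card S = card (S \<inter> E) + card (S \<inter> A) + card (S \<inter> B) + card (S \<inter> C)
    + card (S \<inter> P) + card (S \<inter> Q)"
proof -
  have "card S = card (S \<inter> (E \<union> A \<union> B \<union> C \<union> P \<union> Q))"
    using assms verts by (simp add: Int_absorb2)
  also have "\<dots> = card (S \<inter> E) + card (S \<inter> A) + card (S \<inter> B) + card (S \<inter> C)
    + card (S \<inter> P) + card (S \<inter> Q)"
    using finite_classes disjoint_classes by (simp add: card_Int_Un_disjoint Int_Un_distrib2)
  finally show ?thesis .
qed

text \<open>Neighborhoods are unions of classes, so both neighbor counts are constant on each class
  and sums of class counts. The natural-number subtractions never truncate, by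
  \<open>card_Int_classes_le\<close>.\<close>

lemma global_offensive_alliance_iff:
  "global_offensive_alliance G S \<longleftrightarrow> S \<noteq> {} \<and> S \<subseteq> pverts G \<and>
     (card (S \<inter> E) < 1 \<longrightarrow> card (S \<inter> A) + card (S \<inter> B) + card (S \<inter> C) \<ge>
        (k - card (S \<inter> A)) + (f - card (S \<inter> B)) + (k * f - card (S \<inter> C)) + 1) \<and>
     (card (S \<inter> A) < k \<longrightarrow> card (S \<inter> E) + card (S \<inter> B) + card (S \<inter> Q) \<ge>
        (1 - card (S \<inter> E)) + (f - card (S \<inter> B)) + (f - card (S \<inter> Q)) + 1) \<and>
     (card (S \<inter> B) < f \<longrightarrow> card (S \<inter> E) + card (S \<inter> A) + card (S \<inter> P) \<ge>
        (1 - card (S \<inter> E)) + (k - card (S \<inter> A)) + (k - card (S \<inter> P)) + 1) \<and>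
     (card (S \<inter> C) < k * f \<longrightarrow> card (S \<inter> E) \<ge> (1 - card (S \<inter> E)) + 1) \<and>
     (card (S \<inter> P) < k \<longrightarrow> card (S \<inter> B) \<ge> (f - card (S \<inter> B)) + 1) \<and>
     (card (S \<inter> Q) < f \<longrightarrow> card (S \<inter> A) \<ge> (k - card (S \<inter> A)) + 1)"
proof -
  let ?ok = "\<lambda>v. nbr_count G S v \<ge> nbr_count G (pverts G - S) v + 1"
  have "(\<forall>v\<in>pverts G - S. ?ok v) \<longleftrightarrow>
      (\<forall>v\<in>E - S. ?ok v) \<and> (\<forall>v\<in>A - S. ?ok v) \<and> (\<forall>v\<in>B - S. ?ok v) \<and>
      (\<forall>v\<in>C - S. ?ok v) \<and> (\<forall>v\<in>P - S. ?ok v) \<and> (\<forall>v\<in>Q - S. ?ok v)"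
    unfolding verts by blast
  \<comment> \<open>Stated for an arbitrary class \<open>X\<close> with constant counts
    \<open>m\<close> and \<open>m'\<close>, then instantiated for the six classes.\<close>
  moreover have "(\<forall>v\<in>X - S. ?ok v) \<longleftrightarrow> (card (S \<inter> X) < card X \<longrightarrow> m \<ge> m' + 1)"
    if "finite X" "\<And>v. v \<in> X \<Longrightarrow> nbr_count G S v = m"
      "\<And>v. v \<in> X \<Longrightarrow> nbr_count G (pverts G - S) v = m'" for X m m'
    using that ball_diff_const_iff[of X S "m \<ge> m' + 1"] by simp
  note this[OF finite_classes(1) nbr_counts(1) nbr_counts(1)]
    this[OF finite_classes(2) nbr_counts(2) nbr_counts(2)]
    this[OF finite_classes(3) nbr_counts(3) nbr_counts(3)]
    this[OF finite_classes(4) nbr_counts(4) nbr_counts(4)]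
    this[OF finite_classes(5) nbr_counts(5) nbr_counts(5)]
    this[OF finite_classes(6) nbr_counts(6) nbr_counts(6)]
  ultimately show ?thesis
    unfolding global_offensive_alliance_def by (simp only: card_complement_Int card_classes)
qed

section \<open>Lower bound for the size of an alliance\<close>

definition alliance_min :: nat where
  "alliance_min = Min {2 * k, 2 * f, f + k div 2 + 1, k + f div 2 + 1}"

text \<open>The lower bound uses the minimum only through these four inequalities, so linear
  arithmetic can treat it as an opaque number.\<close>

lemma alliance_min_le:
  "alliance_min \<le> 2 * k" "alliance_min \<le> 2 * f"
  "alliance_min \<le> f + k div 2 + 1" "alliance_min \<le> k + f div 2 + 1"
  unfolding alliance_min_def by (intro Min_le; simp)+

lemma alliance_card_ge:
  assumes "global_offensive_alliance G S"
  shows "card S \<ge> 1 + alliance_min"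
proof -
  obtain x a b c p q where counts: "x = card (S \<inter> E)" "a = card (S \<inter> A)" "b = card (S \<inter> B)"
    "c = card (S \<inter> C)" "p = card (S \<inter> P)" "q = card (S \<inter> Q)"
    by blast
  have card_S: "card S = x + a + b + c + p + q"
    using assms card_eq_sum_classes counts by (simp add: global_offensive_alliance_def)
  note le = card_Int_classes_le[of S, folded counts]
  have "a < k \<longrightarrow> x + b + q \<ge> (1 - x) + (f - b) + (f - q) + 1"
    and "b < f \<longrightarrow> x + a + p \<ge> (1 - x) + (k - a) + (k - p) + 1"
    and C: "c < k * f \<longrightarrow> x \<ge> (1 - x) + 1"
    and P: "p < k \<longrightarrow> b \<ge> (f - b) + 1" and Q: "q < f \<longrightarrow> a \<ge> (k - a) + 1"
    using assms unfolding global_offensive_alliance_iff counts by blast+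
  \<comment> \<open>Clearing the subtractions in the first inequality gives
    \<open>2 * (x + b + q) \<ge> 2 * f + 2\<close>, which is then halved; the second is
    symmetric.\<close>
  then have A: "a < k \<longrightarrow> b + q + x \<ge> f + 1" and B: "b < f \<longrightarrow> a + p + x \<ge> k + 1"
    using le by linarith+
  have kf: "k * f \<ge> k" "k * f \<ge> f"
    using sizes by auto
  \<comment> \<open>The vertex of \<open>E\<close> is the only neighbor of each vertex of
    \<open>C\<close>. If it is missing, all of \<open>C\<close> must be taken, and these at least
    two vertices more than replace it.\<close>
  have x: "x = 1 \<or> x = 0 \<and> c = k * f"
    using C le by linarith
  have "k * f \<ge> f div 2 + 1" "k * f \<ge> k div 2 + 1"
  proof -
    have "k * f \<ge> 2 * k" using sizes by simp
    then show "k * f \<ge> f div 2 + 1" "k * f \<ge> k div 2 + 1"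
      using kf sizes by linarith+
  qed
  note kf = kf this
  consider "a = k" "b = f" | "a = k" "b < f" | "a < k" "b = f" | "a < k" "b < f"
    using le by linarith
  then show ?thesis
  proof cases
    \<comment> \<open>Here \<open>k \<ge> k div 2 + 1\<close>, since
      \<open>k \<ge> 1\<close>.\<close>
    case 1
    then show ?thesis using x kf card_S alliance_min_le(3) sizes by linarith
  next
    \<comment> \<open>If \<open>p = k\<close>, then \<open>A\<close> and \<open>P\<close> contribute
      \<open>2 * k\<close>. Otherwise \<open>P\<close> forces \<open>2 * b \<ge> f + 1\<close>, that
      is \<open>b \<ge> f div 2 + 1\<close>. Case 3 is symmetric.\<close>
    case 2
    then show ?thesis using x kf card_S alliance_min_le(1,4) sizes B P le by linarith
  next
    case 3
    then show ?thesis using x kf card_S alliance_min_le(2,3) sizes A Q le by linarith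
  next
    \<comment> \<open>Adding \<open>A\<close> and \<open>B\<close> counts \<open>x\<close> twice, so
      \<open>a + b + p + q \<ge> k + f + 2 - 2 * x\<close>, which is at least
      \<open>k + f\<close>.\<close>
    case 4
    then show ?thesis using x kf card_S alliance_min_le(3) sizes A B le by linarith
  qed
qed

section \<open>Alliances attaining the four values\<close>

lemma classes_subset:
  "E \<subseteq> pverts G" "A \<subseteq> pverts G" "B \<subseteq> pverts G" "P \<subseteq> pverts G" "Q \<subseteq> pverts G"
  unfolding verts by auto

text \<open>The set is the full neighborhood of any vertex of \<open>B\<close>. It also contains all
  neighbors of \<open>C\<close> and \<open>Q\<close>, so no outside vertex has a neighbor
  outside.\<close>

lemma alliance_E_A_P:
  "global_offensive_alliance G (E \<union> A \<union> P)" "card (E \<union> A \<union> P) = 1 + 2 * k"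
proof -
  let ?S = "E \<union> A \<union> P"
  have "?S \<inter> E = E" "?S \<inter> A = A" "?S \<inter> B = {}" "?S \<inter> C = {}" "?S \<inter> P = P" "?S \<inter> Q = {}"
    using disjoint_classes by auto
  then have counts: "card (?S \<inter> E) = 1" "card (?S \<inter> A) = k" "card (?S \<inter> B) = 0"
    "card (?S \<inter> C) = 0" "card (?S \<inter> P) = k" "card (?S \<inter> Q) = 0"
    using card_classes by simp_all
  have "?S \<noteq> {}" using card_classes(1) by auto
  moreover have sub: "?S \<subseteq> pverts G" using classes_subset by blast
  ultimately show "global_offensive_alliance G ?S"
    unfolding global_offensive_alliance_iff counts using sizes by auto
  show "card ?S = 1 + 2 * k"
    using card_eq_sum_classes[OF sub] counts by simp
qed

text \<open>The strict majority \<open>f div 2 + 1\<close> of \<open>B\<close> serves the vertices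
  of \<open>P\<close>. For the rest of \<open>B\<close> the inequality is tight:
  \<open>1 + k\<close> neighbors inside, the \<open>k\<close> vertices of \<open>P\<close>
  outside.\<close>

lemma alliance_E_A_half_B:
  assumes "D \<subseteq> B" "card D = f div 2 + 1"
  shows "global_offensive_alliance G (E \<union> A \<union> D)" "card (E \<union> A \<union> D) = 1 + (k + f div 2 + 1)"
proof -
  let ?S = "E \<union> A \<union> D"
  have "?S \<inter> E = E" "?S \<inter> A = A" "?S \<inter> B = D" "?S \<inter> C = {}" "?S \<inter> P = {}" "?S \<inter> Q = {}"
    using disjoint_classes assms(1) by auto
  then have counts: "card (?S \<inter> E) = 1" "card (?S \<inter> A) = k" "card (?S \<inter> B) = f div 2 + 1"
    "card (?S \<inter> C) = 0" "card (?S \<inter> P) = 0" "card (?S \<inter> Q) = 0"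
    using card_classes assms(2) by simp_all
  have "?S \<noteq> {}" using card_classes(1) by auto
  moreover have sub: "?S \<subseteq> pverts G" using classes_subset assms(1) by blast
  ultimately show "global_offensive_alliance G ?S"
    unfolding global_offensive_alliance_iff counts using sizes by auto
  show "card ?S = 1 + (k + f div 2 + 1)"
    using card_eq_sum_classes[OF sub] counts by simp
qed

lemma alliance_E_B_Q:
  "global_offensive_alliance G (E \<union> B \<union> Q)" "card (E \<union> B \<union> Q) = 1 + 2 * f"
proof -
  let ?S = "E \<union> B \<union> Q"
  have "?S \<inter> E = E" "?S \<inter> A = {}" "?S \<inter> B = B" "?S \<inter> C = {}" "?S \<inter> P = {}" "?S \<inter> Q = Q"
    using disjoint_classes by auto
  then have counts: "card (?S \<inter> E) = 1" "card (?S \<inter> A) = 0" "card (?S \<inter> B) = f"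
    "card (?S \<inter> C) = 0" "card (?S \<inter> P) = 0" "card (?S \<inter> Q) = f"
    using card_classes by simp_all
  have "?S \<noteq> {}" using card_classes(1) by auto
  moreover have sub: "?S \<subseteq> pverts G" using classes_subset by blast
  ultimately show "global_offensive_alliance G ?S"
    unfolding global_offensive_alliance_iff counts using sizes by auto
  show "card ?S = 1 + 2 * f"
    using card_eq_sum_classes[OF sub] counts by simp
qed

text \<open>Mirror image of \<open>alliance_E_A_half_B\<close>: the majority of \<open>A\<close>
  serves \<open>Q\<close>, and the rest of \<open>A\<close> has \<open>1 + f\<close> neighbors
  inside against \<open>f\<close> outside.\<close>

lemma alliance_E_half_A_B:
  assumes "D \<subseteq> A" "card D = k div 2 + 1"
  shows "global_offensive_alliance G (E \<union> D \<union> B)" "card (E \<union> D \<union> B) = 1 + (f + k div 2 + 1)"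
proof -
  let ?S = "E \<union> D \<union> B"
  have "?S \<inter> E = E" "?S \<inter> A = D" "?S \<inter> B = B" "?S \<inter> C = {}" "?S \<inter> P = {}" "?S \<inter> Q = {}"
    using disjoint_classes assms(1) by auto
  then have counts: "card (?S \<inter> E) = 1" "card (?S \<inter> A) = k div 2 + 1" "card (?S \<inter> B) = f"
    "card (?S \<inter> C) = 0" "card (?S \<inter> P) = 0" "card (?S \<inter> Q) = 0"
    using card_classes assms(2) by simp_all
  have "?S \<noteq> {}" using card_classes(1) by auto
  moreover have sub: "?S \<subseteq> pverts G" using classes_subset assms(1) by blast
  ultimately show "global_offensive_alliance G ?S"
    unfolding global_offensive_alliance_iff counts using sizes by auto
  show "card ?S = 1 + (f + k div 2 + 1)"
    using card_eq_sum_classes[OF sub] counts by simp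
qed

lemma ex_alliance_card:
  "\<exists>S. global_offensive_alliance G S \<and> card S = 1 + alliance_min"
proof -
  have "k div 2 + 1 \<le> card A" "f div 2 + 1 \<le> card B"
    using sizes card_classes by linarith+
  then obtain A' B' where half: "A' \<subseteq> A" "card A' = k div 2 + 1" "B' \<subseteq> B" "card B' = f div 2 + 1"
    by (meson obtain_subset_with_card_n)
  have "alliance_min \<in> {2 * k, 2 * f, f + k div 2 + 1, k + f div 2 + 1}"
    unfolding alliance_min_def by (rule Min_in) auto
  then consider "alliance_min = 2 * k" | "alliance_min = 2 * f"
    | "alliance_min = f + k div 2 + 1" | "alliance_min = k + f div 2 + 1"
    by blast
  then show ?thesis
    using alliance_E_A_P alliance_E_B_Q alliance_E_half_A_B[OF half(1,2)]
      alliance_E_A_half_B[OF half(3,4)]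
    by cases metis+
qed

theorem global_offensive_alliance_number_eq:
  "global_offensive_alliance_number G =
     1 + Min {2 * k, 2 * f, f + k div 2 + 1, k + f div 2 + 1}"
  unfolding global_offensive_alliance_number_def alliance_min_def[symmetric]
  by (rule Least_equality) (use ex_alliance_card alliance_card_ge in auto)

end

section \<open>The zero-divisor graph of the product ring as an instance\<close>

lemma three_support_graph_zero_divisor_graph:
  fixes K :: "('k, 'm) ring_scheme" and F :: "('f, 'n) ring_scheme"
  assumes "field K" and "finite (carrier K)"
    and "field F" and "finite (carrier F)" and "card (carrier F) \<ge> 3"
  defines "K' \<equiv> carrier K - {\<zero>\<^bsub>K\<^esub>}" and "F' \<equiv> carrier F - {\<zero>\<^bsub>F\<^esub>}"
  shows "three_support_graph (zero_divisor_graph (RDirProd (residue_ring 2) (RDirProd K F)))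
    {(1, \<zero>\<^bsub>K\<^esub>, \<zero>\<^bsub>F\<^esub>)} ({0} \<times> K' \<times> {\<zero>\<^bsub>F\<^esub>}) ({0} \<times> {\<zero>\<^bsub>K\<^esub>} \<times> F') ({0} \<times> K' \<times> F')
    ({1} \<times> K' \<times> {\<zero>\<^bsub>F\<^esub>}) ({1} \<times> {\<zero>\<^bsub>K\<^esub>} \<times> F') (card K') (card F')"
proof -
  interpret K: field K by fact
  interpret F: field F by fact
  let ?R = "RDirProd (residue_ring 2) (RDirProd K F)"
  let ?G = "zero_divisor_graph ?R"
  have carrier: "carrier ?R = {0, 1} \<times> carrier K \<times> carrier F"
    by (auto simp: RDirProd_carrier residue_ring_def)
  have zero: "\<zero>\<^bsub>?R\<^esub> = (0, \<zero>\<^bsub>K\<^esub>, \<zero>\<^bsub>F\<^esub>)"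
    by (simp add: RDirProd_def DirProd_def monoid.defs residue_ring_def)
  \<comment> \<open>All three factors are integral domains, so a product vanishes exactly when the
    supports are disjoint.\<close>
  have mult_zero: "(i, x, y) \<otimes>\<^bsub>?R\<^esub> (j, z, w) = \<zero>\<^bsub>?R\<^esub> \<longleftrightarrow>
      (i = 0 \<or> j = 0) \<and> (x = \<zero>\<^bsub>K\<^esub> \<or> z = \<zero>\<^bsub>K\<^esub>) \<and> (y = \<zero>\<^bsub>F\<^esub> \<or> w = \<zero>\<^bsub>F\<^esub>)"
    if "(i, x, y) \<in> carrier ?R" "(j, z, w) \<in> carrier ?R" for i j x y z w
  proof -
    have "(i, x, y) \<otimes>\<^bsub>?R\<^esub> (j, z, w) = (i * j mod 2, x \<otimes>\<^bsub>K\<^esub> z, y \<otimes>\<^bsub>F\<^esub> w)"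
      by (simp add: RDirProd_def DirProd_def monoid.defs residue_ring_def)
    moreover have "i * j mod 2 = 0 \<longleftrightarrow> i = 0 \<or> j = 0"
      using that unfolding carrier by auto
    ultimately show ?thesis
      using that unfolding carrier zero by (simp add: K.integral_iff F.integral_iff)
  qed
  have zd: "(i, x, y) \<in> zero_divisors ?R \<longleftrightarrow>
      (i, x, y) \<in> carrier ?R \<and> (i = 0 \<or> x = \<zero>\<^bsub>K\<^esub> \<or> y = \<zero>\<^bsub>F\<^esub>)" for i x y
  proof
    assume "(i, x, y) \<in> zero_divisors ?R"
    then obtain j z w where "(i, x, y) \<in> carrier ?R" "(j, z, w) \<in> carrier ?R"
      "(j, z, w) \<noteq> \<zero>\<^bsub>?R\<^esub>" "(i, x, y) \<otimes>\<^bsub>?R\<^esub> (j, z, w) = \<zero>\<^bsub>?R\<^esub>"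
      unfolding zero_divisors_def by auto
    then show "(i, x, y) \<in> carrier ?R \<and> (i = 0 \<or> x = \<zero>\<^bsub>K\<^esub> \<or> y = \<zero>\<^bsub>F\<^esub>)"
      using mult_zero zero by auto
  next
    assume *: "(i, x, y) \<in> carrier ?R \<and> (i = 0 \<or> x = \<zero>\<^bsub>K\<^esub> \<or> y = \<zero>\<^bsub>F\<^esub>)"
    \<comment> \<open>The annihilator is the unit vector at the first coordinate where
      \<open>(i, x, y)\<close> vanishes.\<close>
    define b where "b = (if i = 0 then (1, \<zero>\<^bsub>K\<^esub>, \<zero>\<^bsub>F\<^esub>)
      else if x = \<zero>\<^bsub>K\<^esub> then (0, \<one>\<^bsub>K\<^esub>, \<zero>\<^bsub>F\<^esub>) else (0 :: int, \<zero>\<^bsub>K\<^esub>, \<one>\<^bsub>F\<^esub>))"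
    have b: "b \<in> carrier ?R" "b \<noteq> \<zero>\<^bsub>?R\<^esub>"
      unfolding b_def carrier zero by auto
    moreover have "(i, x, y) \<otimes>\<^bsub>?R\<^esub> b = \<zero>\<^bsub>?R\<^esub>"
      using * b(1) mult_zero[of i x y "fst b" "fst (snd b)" "snd (snd b)"]
      by (auto simp: b_def split: if_splits)
    ultimately show "(i, x, y) \<in> zero_divisors ?R"
      using * unfolding zero_divisors_def by blast
  qed
  have verts: "(i, x, y) \<in> pverts ?G \<longleftrightarrow> i \<in> {0, 1} \<and> x \<in> carrier K \<and> y \<in> carrier F \<and>
      (i = 0 \<or> x = \<zero>\<^bsub>K\<^esub> \<or> y = \<zero>\<^bsub>F\<^esub>) \<and> \<not> (i = 0 \<and> x = \<zero>\<^bsub>K\<^esub> \<and> y = \<zero>\<^bsub>F\<^esub>)" for i x y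
    by (auto simp: zero_divisor_graph_def zd zero carrier)
  have arcs_raw: "((i, x, y), (j, z, w)) \<in> parcs ?G \<longleftrightarrow>
      (i, x, y) \<in> pverts ?G \<and> (j, z, w) \<in> pverts ?G \<and> (i, x, y) \<noteq> (j, z, w) \<and>
      (i, x, y) \<otimes>\<^bsub>?R\<^esub> (j, z, w) = \<zero>\<^bsub>?R\<^esub>" for i x y j z w
    by (simp add: zero_divisor_graph_def Let_def)
  have arcs: "((i, x, y), (j, z, w)) \<in> parcs ?G \<longleftrightarrow>
      (i, x, y) \<in> pverts ?G \<and> (j, z, w) \<in> pverts ?G \<and>
      (i = 0 \<or> j = 0) \<and> (x = \<zero>\<^bsub>K\<^esub> \<or> z = \<zero>\<^bsub>K\<^esub>) \<and> (y = \<zero>\<^bsub>F\<^esub> \<or> w = \<zero>\<^bsub>F\<^esub>)" for i x y j z w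
  proof (cases "(i, x, y) \<in> pverts ?G \<and> (j, z, w) \<in> pverts ?G")
    case True
    then have "(i, x, y) \<in> carrier ?R" "(j, z, w) \<in> carrier ?R"
      by (simp_all add: verts carrier)
    note mult_zero[OF this]
    moreover have "\<not> (i = 0 \<and> x = \<zero>\<^bsub>K\<^esub> \<and> y = \<zero>\<^bsub>F\<^esub>)"
      using True by (simp add: verts)
    ultimately show ?thesis
      using True unfolding arcs_raw by auto
  next
    case False
    then show ?thesis unfolding arcs_raw by blast
  qed
  have fin: "finite K'" "finite F'"
    using assms by auto
  have notin: "\<zero>\<^bsub>K\<^esub> \<notin> K'" "\<zero>\<^bsub>F\<^esub> \<notin> F'"
    by (auto simp: K'_def F'_def)
  \<comment> \<open>A field has a nonzero element, which suffices for \<open>K\<close>; the bound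
    for \<open>F'\<close> comes from \<open>card (carrier F) \<ge> 3\<close>.\<close>
  have sizes: "card K' \<ge> 1" "card F' \<ge> 2"
  proof -
    have "\<one>\<^bsub>K\<^esub> \<in> K'" by (simp add: K'_def)
    then show "card K' \<ge> 1" using fin by (metis One_nat_def Suc_leI card_gt_0_iff empty_iff)
    show "card F' \<ge> 2" using assms(4,5) by (simp add: F'_def card_Diff_singleton)
  qed
  show ?thesis
  proof
    show "pverts ?G = {(1, \<zero>\<^bsub>K\<^esub>, \<zero>\<^bsub>F\<^esub>)} \<union> {0} \<times> K' \<times> {\<zero>\<^bsub>F\<^esub>} \<union> {0} \<times> {\<zero>\<^bsub>K\<^esub>} \<times> F' \<union>
        {0} \<times> K' \<times> F' \<union> {1} \<times> K' \<times> {\<zero>\<^bsub>F\<^esub>} \<union> {1} \<times> {\<zero>\<^bsub>K\<^esub>} \<times> F'"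
      by (rule set_triple_eqI)
        (simp add: verts K'_def F'_def, metis zero_neq_one K.zero_closed F.zero_closed)
  next
    fix v assume "v \<in> {(1 :: int, \<zero>\<^bsub>K\<^esub>, \<zero>\<^bsub>F\<^esub>)}"
    then have v: "v = (1, \<zero>\<^bsub>K\<^esub>, \<zero>\<^bsub>F\<^esub>)" by simp
    show "{u. (v, u) \<in> parcs ?G} =
        {0} \<times> K' \<times> {\<zero>\<^bsub>F\<^esub>} \<union> {0} \<times> {\<zero>\<^bsub>K\<^esub>} \<times> F' \<union> {0} \<times> K' \<times> F'"
      by (rule set_triple_eqI) (use v in \<open>auto simp: arcs verts K'_def F'_def\<close>)
  next
    fix v assume "v \<in> {0 :: int} \<times> K' \<times> {\<zero>\<^bsub>F\<^esub>}"
    then obtain x where v: "v = (0, x, \<zero>\<^bsub>F\<^esub>)" "x \<in> carrier K" "x \<noteq> \<zero>\<^bsub>K\<^esub>"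
      by (auto simp: K'_def F'_def)
    show "{u. (v, u) \<in> parcs ?G} =
        {(1, \<zero>\<^bsub>K\<^esub>, \<zero>\<^bsub>F\<^esub>)} \<union> {0} \<times> {\<zero>\<^bsub>K\<^esub>} \<times> F' \<union> {1} \<times> {\<zero>\<^bsub>K\<^esub>} \<times> F'"
      by (rule set_triple_eqI) (use v in \<open>auto simp: arcs verts K'_def F'_def\<close>)
  next
    fix v assume "v \<in> {0 :: int} \<times> {\<zero>\<^bsub>K\<^esub>} \<times> F'"
    then obtain y where v: "v = (0, \<zero>\<^bsub>K\<^esub>, y)" "y \<in> carrier F" "y \<noteq> \<zero>\<^bsub>F\<^esub>"
      by (auto simp: K'_def F'_def)
    show "{u. (v, u) \<in> parcs ?G} =
        {(1, \<zero>\<^bsub>K\<^esub>, \<zero>\<^bsub>F\<^esub>)} \<union> {0} \<times> K' \<times> {\<zero>\<^bsub>F\<^esub>} \<union> {1} \<times> K' \<times> {\<zero>\<^bsub>F\<^esub>}"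
      by (rule set_triple_eqI) (use v in \<open>auto simp: arcs verts K'_def F'_def\<close>)
  next
    fix v assume "v \<in> {0 :: int} \<times> K' \<times> F'"
    then obtain x y where v: "v = (0, x, y)" "x \<in> carrier K" "x \<noteq> \<zero>\<^bsub>K\<^esub>" "y \<in> carrier F" "y \<noteq> \<zero>\<^bsub>F\<^esub>"
      by (auto simp: K'_def F'_def)
    show "{u. (v, u) \<in> parcs ?G} = {(1, \<zero>\<^bsub>K\<^esub>, \<zero>\<^bsub>F\<^esub>)}"
      by (rule set_triple_eqI) (use v in \<open>auto simp: arcs verts K'_def F'_def\<close>)
  next
    fix v assume "v \<in> {1 :: int} \<times> K' \<times> {\<zero>\<^bsub>F\<^esub>}"
    then obtain x where v: "v = (1, x, \<zero>\<^bsub>F\<^esub>)" "x \<in> carrier K" "x \<noteq> \<zero>\<^bsub>K\<^esub>"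
      by (auto simp: K'_def F'_def)
    show "{u. (v, u) \<in> parcs ?G} = {0} \<times> {\<zero>\<^bsub>K\<^esub>} \<times> F'"
      by (rule set_triple_eqI) (use v in \<open>auto simp: arcs verts K'_def F'_def\<close>)
  next
    fix v assume "v \<in> {1 :: int} \<times> {\<zero>\<^bsub>K\<^esub>} \<times> F'"
    then obtain y where v: "v = (1, \<zero>\<^bsub>K\<^esub>, y)" "y \<in> carrier F" "y \<noteq> \<zero>\<^bsub>F\<^esub>"
      by (auto simp: K'_def F'_def)
    show "{u. (v, u) \<in> parcs ?G} = {0} \<times> K' \<times> {\<zero>\<^bsub>F\<^esub>}"
      by (rule set_triple_eqI) (use v in \<open>auto simp: arcs verts K'_def F'_def\<close>)
  \<comment> \<open>Finiteness, disjointness and cardinalities remain; classes with equal first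
    coordinate are separated by \<open>notin\<close>.\<close>
  qed (use fin notin sizes in \<open>auto simp: card_cartesian_product\<close>)
qed

theorem theorem2p11:
  fixes K :: "('k, 'm) ring_scheme" and F :: "('f, 'n) ring_scheme"
  assumes "field K" and "finite (carrier K)"
    and "field F" and "finite (carrier F)"
    and "card (carrier F) \<ge> 3"
  shows "global_offensive_alliance_number
           (zero_divisor_graph (RDirProd (residue_ring 2) (RDirProd K F))) =
         1 + Min {2 * card (carrier K - {\<zero>\<^bsub>K\<^esub>}),
                  2 * card (carrier F - {\<zero>\<^bsub>F\<^esub>}),
                  card (carrier F - {\<zero>\<^bsub>F\<^esub>}) + card (carrier K - {\<zero>\<^bsub>K\<^esub>}) div 2 + 1,
                  card (carrier K - {\<zero>\<^bsub>K\<^esub>}) + card (carrier F - {\<zero>\<^bsub>F\<^esub>}) div 2 + 1}"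
  by (rule three_support_graph.global_offensive_alliance_number_eq
      [OF three_support_graph_zero_divisor_graph[OF assms]])

end
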